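(* For the calculus $\lambda^\Box$ with the $\beta$-reduction rules $(\lambda x.M)N\to[N/x]M$ and ${,}\grave{}M\to M$ (closed under all term constructors), subject reduction holds (reduction preserves typing judgments), every well-typed term is strongly normalizing, and reduction is Church–Rosser (confluent).
   Context: Calculus $\lambda^\Box$: levels are natural numbers; types of level $l$ are base types $\iota^l$, $A^l\to B^l$, and (for $l\ge1$) $\Box A^{l-1}$. A context of level $l$ is a list of variable declarations of level-$l$ types; a context stack of level $l$ is a sequence $\Gamma^{l+n-1};\dots;\Gamma^l$ ($n\ge0$) with levels decreasing by one from left to right. Rules: (Var) if $x:A\in\Gamma^l$ then $\Delta^{l+1};\Gamma^l\vdash^l x:A$; (Abs) from $\Delta^{l+1};\Gamma^l,x:A\vdash^l M:B$ infer $\Delta^{l+1};\Gamma^l\vdash^l\lambda x.M:A\to B$; (App) from $\Delta^l\vdash^l M:A\to B$ and $\Delta^l\vdash^l N:A$ infer $\Delta^l\vdash^l MN:B$; (Quo) from $\Delta^{l+1};\cdot\vdash^l M:A$ infer $\Delta^{l+1}\vdash^{l+1}\grave{}M:\Box A$; (Unq) from $\Delta^{l+1}\vdash^{l+1}M:\Box A$ infer $\Delta^{l+1};\Gamma^l\vdash^l{,}M:A$ for any context $\Gamma^l$. Substitution is level-aware: $[N/x]M := [N/x]_0M$, where $[N/x]_n y = N$ if $n=0$ and $y=x$, and $y$ otherwise; $[N/x]_n\grave{}M = \grave{}[N/x]_{n+1}M$; $[N/x]_n{,}M = {,}[N/x]_{n-1}M$ if $n>0$ and ${,}M$ if $n=0$;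 on abstraction and application it acts homomorphically (capture-avoiding). *)

theory Defs
  imports Main
begin

text \<open>
  Terms are taken modulo alpha-equivalence by means of de Bruijn indices. Since every level of
  a context stack has its own context, an index counts only binders of the level at which the
  variable occurs: a binder binds occurrences on its own level, a quotation opens a new (empty)
  innermost context, and an unquotation leaves the innermost context. For example, in
  \<open>Abs (Abs (Unq (Var 0)))\<close> the variable refers to the next outer level of the stack and is bound
  by neither abstraction.
\<close>

text \<open>\<open>'b\<close> is the set of base type names; \<open>Base l b\<close> is the base type \<open>b\<close> of level \<open>l\<close>.\<close>

datatype 'b ty =
    Base nat 'b
  | Arrow "'b ty" "'b ty" (infixr "\<rightarrow>\<^sub>t" 200)
  | Box "'b ty"

inductive ty_level :: "nat \<Rightarrow> 'b ty \<Rightarrow> bool" where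
  "ty_level l (Base l b)"
| "ty_level l A \<Longrightarrow> ty_level l B \<Longrightarrow> ty_level l (A \<rightarrow>\<^sub>t B)"
| "ty_level l A \<Longrightarrow> ty_level (Suc l) (Box A)"

text \<open>
  The most recently declared variable is the head of a context, and the rightmost (lowest)
  context of a stack is the head of the stack: \<open>\<Delta>;\<Gamma>\<close> is \<open>\<Gamma> # \<Delta>\<close> and \<open>\<Gamma>, x:A\<close> is \<open>A # \<Gamma>\<close>.
\<close>

type_synonym 'b ctx = "'b ty list"
type_synonym 'b stack = "'b ctx list"

definition ctx_level :: "nat \<Rightarrow> 'b ctx \<Rightarrow> bool" where
  "ctx_level l \<Gamma> \<longleftrightarrow> (\<forall>A \<in> set \<Gamma>. ty_level l A)"

inductive stack_level :: "nat \<Rightarrow> 'b stack \<Rightarrow> bool" where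
  "stack_level l []"
| "stack_level (Suc l) \<Delta> \<Longrightarrow> ctx_level l \<Gamma> \<Longrightarrow> stack_level l (\<Gamma> # \<Delta>)"

datatype tm =
    Var nat
  | Abs tm
  | App tm tm
  | Quo tm
  | Unq tm

text \<open>
  The level side conditions on stacks, contexts and types appear only where a derivation
  introduces them; \<open>typing_level\<close> shows that they hold for every derivable judgment.
\<close>

inductive typing :: "'b stack \<Rightarrow> nat \<Rightarrow> tm \<Rightarrow> 'b ty \<Rightarrow> bool" where
  Var: "stack_level l (\<Gamma> # \<Delta>) \<Longrightarrow> i < length \<Gamma> \<Longrightarrow> \<Gamma> ! i = A \<Longrightarrow> typing (\<Gamma> # \<Delta>) l (Var i) A"
| Abs: "typing ((A # \<Gamma>) # \<Delta>) l M B \<Longrightarrow> typing (\<Gamma> # \<Delta>) l (Abs M) (A \<rightarrow>\<^sub>t B)"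
| App: "typing \<Delta> l M (A \<rightarrow>\<^sub>t B) \<Longrightarrow> typing \<Delta> l N A \<Longrightarrow> typing \<Delta> l (App M N) B"
| Quo: "typing ([] # \<Delta>) l M A \<Longrightarrow> typing \<Delta> (Suc l) (Quo M) (Box A)"
| Unq: "typing \<Delta> (Suc l) M (Box A) \<Longrightarrow> ctx_level l \<Gamma> \<Longrightarrow> typing (\<Gamma> # \<Delta>) l (Unq M) A"

inductive_simps stack_level_Cons: "stack_level l (\<Gamma> # \<Delta>)"
inductive_simps ty_level_Arrow: "ty_level l (A \<rightarrow>\<^sub>t B)"
inductive_simps ty_level_Box: "ty_level (Suc l) (Box A)"

lemma typing_level: "typing \<Delta> l M A \<Longrightarrow> stack_level l \<Delta> \<and> ty_level l A"
  by (induction rule: typing.induct)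
    (auto simp: ctx_level_def stack_level_Cons ty_level_Arrow ty_level_Box)

text \<open>
  \<open>lift n k M\<close> inserts a new variable with index \<open>k\<close> into the context \<open>n\<close> levels above that of
  \<open>M\<close>, renumbering the indices that refer to this context. Like substitution it does not enter an
  unquotation at \<open>n = 0\<close>, where the affected context is left.
\<close>

fun lift :: "nat \<Rightarrow> nat \<Rightarrow> tm \<Rightarrow> tm" where
  "lift n k (Var i) = (if n = 0 \<and> k \<le> i then Var (Suc i) else Var i)"
| "lift n k (Abs M) = Abs (lift n (if n = 0 then Suc k else k) M)"
| "lift n k (App M N) = App (lift n k M) (lift n k N)"
| "lift n k (Quo M) = Quo (lift (Suc n) k M)"
| "lift n k (Unq M) = (case n of 0 \<Rightarrow> Unq M | Suc m \<Rightarrow> Unq (lift m k M))"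

text \<open>
  \<open>subst n k N M\<close> is the substitution \<open>[N/x]\<^sub>n M\<close>, where \<open>x\<close> is the variable with index \<open>k\<close> in the
  context \<open>n\<close> levels above that of \<open>M\<close>. As \<open>x\<close> is removed from its context, larger indices
  into that context decrease. An abstraction passed at \<open>n > 0\<close> declares a variable of a
  lower level than \<open>x\<close>, which shifts neither \<open>x\<close> nor the variables of \<open>N\<close>.
\<close>

fun subst :: "nat \<Rightarrow> nat \<Rightarrow> tm \<Rightarrow> tm \<Rightarrow> tm" where
  "subst n k N (Var i) =
     (if n = 0 then (if i < k then Var i else if i = k then N else Var (i - 1)) else Var i)"
| "subst n k N (Abs M) =
     Abs (if n = 0 then subst n (Suc k) (lift 0 0 N) M else subst n k N M)"
| "subst n k N (App M M') = App (subst n k N M) (subst n k N M')"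
| "subst n k N (Quo M) = Quo (subst (Suc n) k N M)"
| "subst n k N (Unq M) = (case n of 0 \<Rightarrow> Unq M | Suc m \<Rightarrow> Unq (subst m k N M))"

text \<open>
  In the rule for unquoted quotations the term moves from an empty innermost context to an
  arbitrary one; no index has to be renumbered.
\<close>

inductive red :: "tm \<Rightarrow> tm \<Rightarrow> bool" (infix "\<rightarrow>\<^sub>\<beta>" 50) where
  beta: "App (Abs M) N \<rightarrow>\<^sub>\<beta> subst 0 0 N M"
| unquote: "Unq (Quo M) \<rightarrow>\<^sub>\<beta> M"
| Abs: "M \<rightarrow>\<^sub>\<beta> M' \<Longrightarrow> Abs M \<rightarrow>\<^sub>\<beta> Abs M'"
| AppL: "M \<rightarrow>\<^sub>\<beta> M' \<Longrightarrow> App M N \<rightarrow>\<^sub>\<beta> App M' N"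
| AppR: "N \<rightarrow>\<^sub>\<beta> N' \<Longrightarrow> App M N \<rightarrow>\<^sub>\<beta> App M N'"
| Quo: "M \<rightarrow>\<^sub>\<beta> M' \<Longrightarrow> Quo M \<rightarrow>\<^sub>\<beta> Quo M'"
| Unq: "M \<rightarrow>\<^sub>\<beta> M' \<Longrightarrow> Unq M \<rightarrow>\<^sub>\<beta> Unq M'"

definition strongly_normalizing :: "tm \<Rightarrow> bool" where
  "strongly_normalizing M \<longleftrightarrow> \<not> (\<exists>f :: nat \<Rightarrow> tm. f 0 = M \<and> (\<forall>i. f i \<rightarrow>\<^sub>\<beta> f (Suc i)))"

text \<open>
  Confluence is a property of well-typed terms: the raw term \<open>App (Abs (Unq (Quo (Var 0)))) N\<close>
  reduces both to \<open>N\<close> and, since substitution does not enter the unquotation, to \<open>Var 0\<close>.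
\<close>

definition confluent_at :: "tm \<Rightarrow> bool" where
  "confluent_at M \<longleftrightarrow>
     (\<forall>N\<^sub>1 N\<^sub>2. red\<^sup>*\<^sup>* M N\<^sub>1 \<longrightarrow> red\<^sup>*\<^sup>* M N\<^sub>2 \<longrightarrow> (\<exists>P. red\<^sup>*\<^sup>* N\<^sub>1 P \<and> red\<^sup>*\<^sup>* N\<^sub>2 P))"

end

theory Submission
  imports Defs
begin

text \<open>
  Strong normalization is obtained by erasing quotations and unquotations. On well-typed terms the
  erasure maps a \<open>\<beta>\<close>-step to a \<open>\<beta>\<close>-step and an unquote step to an identity, and unquote steps
  decrease the size; the erased terms are pure \<open>\<lambda>\<close>-terms that are simply typed once \<open>\<box>A\<close> is
  identified with \<open>A\<close>, so Tait's reducibility applies to them. Confluence follows by Newman's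
  lemma from local confluence, where typing ensures that the body of an unquoted quotation does
  not mention the innermost context.
\<close>

section \<open>Simultaneous substitution\<close>

text \<open>
  In \<open>ren\<close> and \<open>psub\<close> the first argument of the map counts levels upwards from that of the term,
  and the second one is an index into the context of that level.
\<close>

definition upr :: "(nat \<Rightarrow> nat \<Rightarrow> nat) \<Rightarrow> nat \<Rightarrow> nat \<Rightarrow> nat" where
  "upr \<xi> = case_nat (case_nat 0 (\<lambda>i. Suc (\<xi> 0 i))) (\<lambda>j. \<xi> (Suc j))"

fun ren :: "(nat \<Rightarrow> nat \<Rightarrow> nat) \<Rightarrow> tm \<Rightarrow> tm" where
  "ren \<xi> (Var i) = Var (\<xi> 0 i)"
| "ren \<xi> (Abs M) = Abs (ren (upr \<xi>) M)"
| "ren \<xi> (App M N) = App (ren \<xi> M) (ren \<xi> N)"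
| "ren \<xi> (Quo M) = Quo (ren (case_nat (\<lambda>i. i) \<xi>) M)"
| "ren \<xi> (Unq M) = Unq (ren (\<lambda>j. \<xi> (Suc j)) M)"

definition shift :: "nat \<Rightarrow> nat \<Rightarrow> nat" where
  "shift = case_nat Suc (\<lambda>j i. i)"

text \<open>\<open>\<sigma> j i\<close> is a term read \<open>j\<close> levels up, in the stack
  without its \<open>j\<close> lowest contexts. A new variable of the lowest context is invisible to
  the images with \<open>j > 0\<close>, so only those with \<open>j = 0\<close> are shifted.\<close>

definition up :: "(nat \<Rightarrow> nat \<Rightarrow> tm) \<Rightarrow> nat \<Rightarrow> nat \<Rightarrow> tm" where
  "up \<sigma> = case_nat (case_nat (Var 0) (\<lambda>i. ren shift (\<sigma> 0 i))) (\<lambda>j. \<sigma> (Suc j))"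

fun psub :: "(nat \<Rightarrow> nat \<Rightarrow> tm) \<Rightarrow> tm \<Rightarrow> tm" where
  "psub \<sigma> (Var i) = \<sigma> 0 i"
| "psub \<sigma> (Abs M) = Abs (psub (up \<sigma>) M)"
| "psub \<sigma> (App M N) = App (psub \<sigma> M) (psub \<sigma> N)"
| "psub \<sigma> (Quo M) = Quo (psub (case_nat Var \<sigma>) M)"
| "psub \<sigma> (Unq M) = Unq (psub (\<lambda>j. \<sigma> (Suc j)) M)"

lemma ren_ren: "ren \<xi> (ren \<zeta> M) = ren (\<lambda>j i. \<xi> j (\<zeta> j i)) M"
  by (induction M arbitrary: \<xi> \<zeta>)
    (auto simp: upr_def fun_eq_iff split: nat.split intro!: arg_cong2[where f = ren])

lemma psub_ren: "psub \<sigma> (ren \<xi> M) = psub (\<lambda>j i. \<sigma> j (\<xi> j i)) M"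
  by (induction M arbitrary: \<sigma> \<xi>)
    (auto simp: upr_def up_def fun_eq_iff split: nat.split intro!: arg_cong2[where f = psub])

lemma ren_upr_shift: "ren (upr \<xi>) (ren shift M) = ren shift (ren \<xi> M)"
  by (auto simp: ren_ren upr_def shift_def fun_eq_iff split: nat.split
      intro!: arg_cong2[where f = ren])

text \<open>An image \<open>\<sigma> j i\<close> sees the stack only from level \<open>j\<close>
  upwards, so it is renamed by the map without its first \<open>j\<close> entries.\<close>

lemma ren_psub: "ren \<xi> (psub \<sigma> M) = psub (\<lambda>j i. ren (\<lambda>j'. \<xi> (j + j')) (\<sigma> j i)) M"
proof (induction M arbitrary: \<sigma> \<xi>)
  case (Abs M)
  have "(\<lambda>j i. ren (\<lambda>j'. upr \<xi> (j + j')) (up \<sigma> j i)) = up (\<lambda>j i. ren (\<lambda>j'. \<xi> (j + j')) (\<sigma> j i))"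
    using ren_upr_shift by (auto simp: up_def fun_eq_iff upr_def split: nat.split)
  then show ?case by (simp add: Abs)
next
  case (Quo M)
  have "(\<lambda>j i. ren (\<lambda>j'. case_nat (\<lambda>i. i) \<xi> (j + j')) (case_nat Var \<sigma> j i)) =
      case_nat Var (\<lambda>j i. ren (\<lambda>j'. \<xi> (j + j')) (\<sigma> j i))"
    by (auto simp: fun_eq_iff split: nat.split)
  then show ?case by (simp add: Quo)
qed auto

lemma psub_up_shift: "psub (up \<sigma>) (ren shift M) = ren shift (psub \<sigma> M)"
proof -
  have "(\<lambda>j i. up \<sigma> j (shift j i)) = (\<lambda>j i. ren (\<lambda>j'. shift (j + j')) (\<sigma> j i))"
  proof -
    \<comment> \<open>Above level 0 \<open>shift\<close> is the identity, so the right-hand side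
      renames the images there by the identity map.\<close>
    have id: "ren (\<lambda>j i. i) N = N" for N
    proof (induction N)
      case (Abs N)
      have "upr (\<lambda>j i. i) = (\<lambda>j i. i)"
        by (auto simp: upr_def fun_eq_iff split: nat.split)
      then show ?case by (simp add: Abs)
    next
      case (Quo N)
      have "case_nat (\<lambda>i. i) (\<lambda>j i. i) = (\<lambda>j i. i :: nat)"
        by (auto simp: fun_eq_iff split: nat.split)
      then show ?case by (simp add: Quo)
    qed auto
    show ?thesis
      by (auto simp: up_def shift_def fun_eq_iff id split: nat.split)
  qed
  then show ?thesis by (simp add: psub_ren ren_psub)
qed

lemma psub_psub: "psub \<sigma> (psub \<tau> M) = psub (\<lambda>j i. psub (\<lambda>j'. \<sigma> (j + j')) (\<tau> j i)) M"
proof (induction M arbitrary: \<sigma> \<tau>)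
  case (Abs M)
  have "(\<lambda>j i. psub (\<lambda>j'. up \<sigma> (j + j')) (up \<tau> j i)) = up (\<lambda>j i. psub (\<lambda>j'. \<sigma> (j + j')) (\<tau> j i))"
    using psub_up_shift by (auto simp: up_def fun_eq_iff split: nat.split)
  then show ?case by (simp add: Abs)
next
  case (Quo M)
  have "(\<lambda>j i. psub (\<lambda>j'. case_nat Var \<sigma> (j + j')) (case_nat Var \<tau> j i)) =
      case_nat Var (\<lambda>j i. psub (\<lambda>j'. \<sigma> (j + j')) (\<tau> j i))"
    by (auto simp: fun_eq_iff split: nat.split)
  then show ?case by (simp add: Quo)
qed auto

lemma up_Var: "up (\<lambda>j. Var) = (\<lambda>j. Var)"
  by (auto simp: up_def shift_def fun_eq_iff split: nat.split)

lemma case_nat_Var: "case_nat Var (\<lambda>j. Var) = (\<lambda>j. Var)"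
  by (auto simp: fun_eq_iff split: nat.split)

lemma psub_Var: "psub (\<lambda>j. Var) M = M"
  by (induction M) (auto simp: up_Var case_nat_Var)

text \<open>This transfers facts on substitution to renaming, such as stability of reduction and the
  behaviour of the identity map.\<close>

lemma ren_eq_psub: "ren \<xi> M = psub (\<lambda>j i. Var (\<xi> j i)) M"
  using ren_psub[of \<xi> "\<lambda>j. Var" M] by (simp add: psub_Var)

section \<open>Lifting and level-aware substitution as simultaneous maps\<close>

lemma lift_eq_ren: "lift n k M = ren (\<lambda>j i. if j = n \<and> k \<le> i then Suc i else i) M"
proof (induction M arbitrary: n k)
  case (Abs M)
  show ?case
    by (auto simp: Abs upr_def fun_eq_iff split: nat.split intro!: arg_cong2[where f = ren])
next
  case (Quo M)
  show ?case
    by (auto simp: Quo fun_eq_iff split: nat.split intro!: arg_cong2[where f = ren])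
next
  case (Unq M)
  \<comment> \<open>At \<open>n = 0\<close> \<open>lift\<close> stops while \<open>ren\<close> goes
    on, but with a map that is the identity on all remaining levels.\<close>
  show ?case
    by (cases n) (simp_all add: Unq ren_eq_psub psub_Var)
qed auto

definition single :: "nat \<Rightarrow> nat \<Rightarrow> tm \<Rightarrow> nat \<Rightarrow> nat \<Rightarrow> tm" where
  "single n k N j i =
     (if j = n then (if i < k then Var i else if i = k then N else Var (i - 1)) else Var i)"

lemma subst_eq_psub: "subst n k N M = psub (single n k N) M"
proof (induction M arbitrary: n k N)
  case (Var i)
  show ?case by (auto simp: single_def)
next
  case (Abs M)
  have "up (single n k N) = single n (if n = 0 then Suc k else k) (if n = 0 then lift 0 0 N else N)"
  proof -
    have "lift 0 0 N = ren shift N"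
      by (auto simp: lift_eq_ren shift_def fun_eq_iff split: nat.split
          intro!: arg_cong2[where f = ren])
    then show ?thesis
      by (auto simp: up_def single_def shift_def fun_eq_iff split: nat.split)
  qed
  then show ?case by (simp add: Abs)
next
  case (Quo M)
  have "case_nat Var (single n k N) = single (Suc n) k N"
    by (auto simp: single_def fun_eq_iff split: nat.split)
  then show ?case by (simp add: Quo)
next
  case (Unq M)
  \<comment> \<open>For \<open>n = 0\<close> the unquotation leaves the only level on which the map
    acts. What remains is the identity, in agreement with \<open>subst\<close> not entering the
    unquotation.\<close>
  have "(\<lambda>j. single 0 k N (Suc j)) = (\<lambda>j. Var)" "(\<lambda>j. single (Suc m) k N (Suc j)) = single m k N" for m
    by (auto simp: single_def fun_eq_iff)
  then show ?case by (cases n) (simp_all add: Unq psub_Var)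
qed auto

lemma psub_single_shift: "psub (single 0 0 N) (ren shift M) = M"
proof -
  have "(\<lambda>j i. single 0 0 N j (shift j i)) = (\<lambda>j. Var)"
    by (auto simp: single_def shift_def fun_eq_iff split: nat.split)
  then show ?thesis by (simp add: psub_ren psub_Var)
qed

text \<open>Both sides are composites of two substitutions, so by \<open>psub_psub\<close> it
  suffices to compare the maps. The shift that \<open>up\<close> inserts is cancelled by
  \<open>single\<close>.\<close>

lemma psub_subst: "psub \<sigma> (subst 0 0 N M) = subst 0 0 (psub \<sigma> N) (psub (up \<sigma>) M)"
proof -
  have "(\<lambda>j i. psub (\<lambda>j'. \<sigma> (j + j')) (single 0 0 N j i)) =
      (\<lambda>j i. psub (\<lambda>j'. single 0 0 (psub \<sigma> N) (j + j')) (up \<sigma> j i))" (is "?l = ?r")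
  proof (intro ext)
    fix j i
    have "(\<lambda>j'. single 0 0 (psub \<sigma> N) (Suc m + j')) = (\<lambda>j. Var)" for m
      by (auto simp: single_def fun_eq_iff)
    then show "?l j i = ?r j i"
      by (cases j; cases i) (auto simp: up_def psub_single_shift psub_Var, simp_all add: single_def)
  qed
  then show ?thesis by (simp add: subst_eq_psub psub_psub)
qed

section \<open>Typing and reduction under substitution\<close>

lemma typing_ren:
  assumes "typing S l M A" "length S' = length S" "stack_level l S'"
    and "\<And>j i. j < length S \<Longrightarrow> i < length (S ! j) \<Longrightarrow> \<xi> j i < length (S' ! j) \<and> S' ! j ! \<xi> j i = S ! j ! i"
  shows "typing S' l (ren \<xi> M) A"
  using assms
proof (induction arbitrary: S' \<xi> rule: typing.induct)
  case (Var l \<Gamma> \<Delta> i A)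
  then obtain \<Gamma>' \<Delta>' where "S' = \<Gamma>' # \<Delta>'" by (cases S') auto
  then show ?case using Var.prems(2) Var.hyps(2,3) Var.prems(3)[of 0 i]
    by (auto intro: typing.Var)
next
  case (Abs A \<Gamma> \<Delta> l M B)
  then obtain \<Gamma>' \<Delta>' where S': "S' = \<Gamma>' # \<Delta>'" by (cases S') auto
  have "typing ((A # \<Gamma>') # \<Delta>') l (ren (upr \<xi>) M) B"
  proof (rule Abs.IH)
    show "stack_level l ((A # \<Gamma>') # \<Delta>')"
      using Abs.prems(2) typing_level[OF Abs.hyps] by (auto simp: S' stack_level_Cons ctx_level_def)
    show "upr \<xi> j i < length (((A # \<Gamma>') # \<Delta>') ! j) \<and>
        ((A # \<Gamma>') # \<Delta>') ! j ! upr \<xi> j i = ((A # \<Gamma>) # \<Delta>) ! j ! i"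
      if "j < length ((A # \<Gamma>) # \<Delta>)" "i < length (((A # \<Gamma>) # \<Delta>) ! j)" for j i
      \<comment> \<open>In the extended context the old variables have moved up by one at level 0,
        and only there.\<close>
      using that Abs.prems(3)[of j "if j = 0 then i - 1 else i"]
      by (auto simp: S' upr_def split: nat.split)
  qed (use Abs.prems S' in auto)
  then show ?case by (auto simp: S' intro: typing.Abs)
next
  case (App \<Delta> l M A B N)
  then show ?case by (metis ren.simps(3) typing.App)
next
  case (Quo \<Delta> l M A)
  have "typing ([] # S') l (ren (case_nat (\<lambda>i. i) \<xi>) M) A"
    by (rule Quo.IH) (use Quo.prems in \<open>auto simp: stack_level_Cons ctx_level_def nth_Cons split: nat.splits\<close>)
  then show ?case by (auto intro: typing.Quo)
next
  case (Unq \<Delta> l M A \<Gamma>)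
  then obtain \<Gamma>' \<Delta>' where S': "S' = \<Gamma>' # \<Delta>'" by (cases S') auto
  have "typing \<Delta>' (Suc l) (ren (\<lambda>j. \<xi> (Suc j)) M) (Box A)"
  proof (rule Unq.IH)
    show "\<xi> (Suc j) i < length (\<Delta>' ! j) \<and> \<Delta>' ! j ! \<xi> (Suc j) i = \<Delta> ! j ! i"
      if "j < length \<Delta>" "i < length (\<Delta> ! j)" for j i
      using that Unq.prems(3)[of "Suc j" i] by (simp add: S')
  qed (use Unq.prems S' in \<open>auto simp: stack_level_Cons\<close>)
  then show ?case using Unq.prems(2) by (auto simp: S' stack_level_Cons intro: typing.Unq)
qed

lemma typing_shift:
  assumes "typing (\<Gamma> # \<Delta>) l M A" "ty_level l B"
  shows "typing ((B # \<Gamma>) # \<Delta>) l (ren shift M) A"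
  using assms(1)
proof (rule typing_ren)
  show "stack_level l ((B # \<Gamma>) # \<Delta>)"
    using assms(2) typing_level[OF assms(1)] by (auto simp: stack_level_Cons ctx_level_def)
qed (auto simp: shift_def split: nat.split)

text \<open>The identity renaming is well typed here, because there are no variables of the
  innermost context whose indices could change. This is what types the contractum of
  \<open>unquote\<close>.\<close>

lemma typing_weaken_empty:
  assumes "typing ([] # \<Delta>) l M A" "ctx_level l \<Gamma>"
  shows "typing (\<Gamma> # \<Delta>) l M A"
proof -
  have "typing (\<Gamma> # \<Delta>) l (ren (\<lambda>j i. i) M) A"
    using assms(1)
  proof (rule typing_ren)
    show "stack_level l (\<Gamma> # \<Delta>)"
      using assms typing_level[OF assms(1)] by (auto simp: stack_level_Cons)
  qed (auto simp: nth_Cons split: nat.splits)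
  then show ?thesis by (simp add: ren_eq_psub psub_Var)
qed

text \<open>The image of a variable \<open>j\<close> levels up must not depend on the
  \<open>j\<close> lowest contexts, since unquotations leave them behind; hence
  \<open>drop j S'\<close>.\<close>

definition typing_sub :: "'b stack \<Rightarrow> nat \<Rightarrow> (nat \<Rightarrow> nat \<Rightarrow> tm) \<Rightarrow> 'b stack \<Rightarrow> bool" where
  "typing_sub S' l \<sigma> S \<longleftrightarrow> length S' = length S \<and> stack_level l S' \<and>
     (\<forall>j < length S. \<forall>i < length (S ! j). typing (drop j S') (l + j) (\<sigma> j i) (S ! j ! i))"

lemma typing_sub_up:
  assumes "typing_sub (\<Gamma>' # \<Delta>') l \<sigma> (\<Gamma> # \<Delta>)" "ty_level l A"
  shows "typing_sub ((A # \<Gamma>') # \<Delta>') l (up \<sigma>) ((A # \<Gamma>) # \<Delta>)"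
  unfolding typing_sub_def
proof (intro conjI allI impI)
  show l: "stack_level l ((A # \<Gamma>') # \<Delta>')"
    using assms by (auto simp: typing_sub_def stack_level_Cons ctx_level_def)
  fix j i assume ji: "j < length ((A # \<Gamma>) # \<Delta>)" "i < length (((A # \<Gamma>) # \<Delta>) ! j)"
  consider "j = 0" "i = 0" | i' where "j = 0" "i = Suc i'" | j' where "j = Suc j'"
    by (cases j; cases i) auto
  then show "typing (drop j ((A # \<Gamma>') # \<Delta>')) (l + j) (up \<sigma> j i) (((A # \<Gamma>) # \<Delta>) ! j ! i)"
  proof cases
    case 1
    then show ?thesis using l by (auto simp: up_def intro: typing.Var)
  next
    case 2
    then have "typing (\<Gamma>' # \<Delta>') l (\<sigma> 0 i') (\<Gamma> ! i')"
      using assms(1) ji by (force simp: typing_sub_def)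
    from typing_shift[OF this assms(2)] show ?thesis using 2 by (simp add: up_def)
  next
    case 3
    then show ?thesis using assms(1) ji by (force simp: typing_sub_def up_def)
  qed
qed (use assms in \<open>simp add: typing_sub_def\<close>)

lemma typing_sub_Quo:
  assumes "typing_sub S' (Suc l) \<sigma> S"
  shows "typing_sub ([] # S') l (case_nat Var \<sigma>) ([] # S)"
  using assms
  by (auto simp: typing_sub_def stack_level_Cons ctx_level_def nth_Cons split: nat.splits)

lemma typing_sub_Unq:
  assumes "typing_sub (\<Gamma>' # \<Delta>') l \<sigma> (\<Gamma> # \<Delta>)"
  shows "typing_sub \<Delta>' (Suc l) (\<lambda>j. \<sigma> (Suc j)) \<Delta>"
  using assms by (force simp: typing_sub_def stack_level_Cons)

lemma typing_sub_ConsE: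
  assumes "typing_sub S' l \<sigma> (\<Gamma> # \<Delta>)"
  obtains \<Gamma>' \<Delta>' where "S' = \<Gamma>' # \<Delta>'" "ctx_level l \<Gamma>'"
  using assms by (cases S') (auto simp: typing_sub_def stack_level_Cons)

lemma typing_psub:
  assumes "typing S l M A" "typing_sub S' l \<sigma> S"
  shows "typing S' l (psub \<sigma> M) A"
  using assms
proof (induction arbitrary: S' \<sigma> rule: typing.induct)
  case (Var l \<Gamma> \<Delta> i A)
  then show ?case by (force simp: typing_sub_def)
next
  case (Abs A \<Gamma> \<Delta> l M B)
  from Abs.prems obtain \<Gamma>' \<Delta>' where S': "S' = \<Gamma>' # \<Delta>'" by (rule typing_sub_ConsE)
  have "ty_level l A" using typing_level[OF Abs.hyps] by (auto simp: stack_level_Cons ctx_level_def)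
  then show ?case
    using Abs typing_sub_up unfolding S' by (fastforce intro: typing.Abs)
next
  case (App \<Delta> l M A B N)
  then show ?case by (metis psub.simps(3) typing.App)
next
  case (Quo \<Delta> l M A)
  then show ?case by (auto intro: typing.Quo typing_sub_Quo)
next
  case (Unq \<Delta> l M A \<Gamma>)
  from Unq.prems obtain \<Gamma>' \<Delta>' where S': "S' = \<Gamma>' # \<Delta>'" "ctx_level l \<Gamma>'" by (rule typing_sub_ConsE)
  then have "typing \<Delta>' (Suc l) (psub (\<lambda>j. \<sigma> (Suc j)) M) (Box A)"
    using Unq.IH Unq.prems typing_sub_Unq by blast
  then show ?case using S' by (auto intro: typing.Unq)
qed

lemma stack_level_drop: "stack_level l S \<Longrightarrow> stack_level (l + j) (drop j S)"
proof (induction j arbitrary: l S)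
  case (Suc j)
  then show ?case
    using Suc.IH[of "Suc l" "tl S"] by (cases S) (auto simp: stack_level_Cons intro: stack_level.intros)
qed simp

lemma typing_sub_single:
  assumes "typing (\<Gamma> # \<Delta>) l N A"
  shows "typing_sub (\<Gamma> # \<Delta>) l (single 0 0 N) ((A # \<Gamma>) # \<Delta>)"
  unfolding typing_sub_def
proof (intro conjI allI impI)
  show l: "stack_level l (\<Gamma> # \<Delta>)" using typing_level[OF assms] by simp
  fix j i assume ji: "j < length ((A # \<Gamma>) # \<Delta>)" "i < length (((A # \<Gamma>) # \<Delta>) ! j)"
  show "typing (drop j (\<Gamma> # \<Delta>)) (l + j) (single 0 0 N j i) (((A # \<Gamma>) # \<Delta>) ! j ! i)"
  proof (cases j)
    case 0
    then show ?thesis using assms l ji by (auto simp: single_def nth_Cons split: nat.split intro: typing.Var)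
  next
    case (Suc j')
    then have "drop j (\<Gamma> # \<Delta>) = (\<Delta> ! j') # drop j \<Delta>"
      using ji by (simp add: Cons_nth_drop_Suc)
    then show ?thesis using stack_level_drop[OF l, of j] ji Suc by (auto simp: single_def intro: typing.Var)
  qed
qed simp

section \<open>Subject reduction\<close>

inductive_cases typing_AbsE: "typing S l (Abs M) A"
inductive_cases typing_AppE: "typing S l (App M N) A"
inductive_cases typing_QuoE: "typing S l (Quo M) A"
inductive_cases typing_UnqE: "typing S l (Unq M) A"

lemma typing_betaE:
  assumes "typing S l (App (Abs M) N) B"
  obtains A \<Gamma> \<Delta> where "S = \<Gamma> # \<Delta>" "typing ((A # \<Gamma>) # \<Delta>) l M B" "typing (\<Gamma> # \<Delta>) l N A"
  using assms by (fastforce elim: typing_AppE typing_AbsE)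

lemma typing_Unq_QuoE:
  assumes "typing S l (Unq (Quo M)) A"
  obtains \<Gamma> \<Delta> where "S = \<Gamma> # \<Delta>" "typing ([] # \<Delta>) l M A" "ctx_level l \<Gamma>"
  using assms by (fastforce elim: typing_UnqE typing_QuoE)

text \<open>A beta step is an instance of well-typed substitution. In an unquote step
  \<open>M\<close> is typed in an empty innermost context and weakens to the one around
  \<open>Unq\<close>.\<close>

lemma subject_reduction:
  assumes "M \<rightarrow>\<^sub>\<beta> M'" "typing S l M A"
  shows "typing S l M' A"
  using assms
proof (induction arbitrary: S l A rule: red.induct)
  case (beta M N)
  then show ?case
    by (metis typing_betaE subst_eq_psub typing_psub typing_sub_single)
next
  case (unquote M)
  then show ?case by (metis typing_Unq_QuoE typing_weaken_empty)
qed (fastforce elim: typing_AbsE typing_AppE typing_QuoE typing_UnqE intro: typing.intros)+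

lemma subject_reductions:
  assumes "red\<^sup>*\<^sup>* M M'" "typing S l M A"
  shows "typing S l M' A"
  using assms by induction (auto intro: subject_reduction)

text \<open>Typing bounds the variables that can occur, so the values of the map on an empty context
  may be exchanged freely.\<close>

lemma psub_cong:
  assumes "typing S l M A" "\<And>j i. j < length S \<Longrightarrow> i < length (S ! j) \<Longrightarrow> \<sigma> j i = \<tau> j i"
  shows "psub \<sigma> M = psub \<tau> M"
  using assms
proof (induction arbitrary: \<sigma> \<tau> rule: typing.induct)
  case (Var l \<Gamma> \<Delta> i A)
  then show ?case using Var.prems[of 0 i] by simp
next
  case (Abs A \<Gamma> \<Delta> l M B)
  have "psub (up \<sigma>) M = psub (up \<tau>) M"
  proof (rule Abs.IH)
    show "up \<sigma> j i = up \<tau> j i"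
      if "j < length ((A # \<Gamma>) # \<Delta>)" "i < length (((A # \<Gamma>) # \<Delta>) ! j)" for j i
      using that Abs.prems[of j "if j = 0 then i - 1 else i"] by (auto simp: up_def split: nat.split)
  qed
  then show ?case by simp
next
  case (App \<Delta> l M A B N)
  then show ?case by (metis psub.simps(3))
next
  case (Quo \<Delta> l M A)
  have "psub (case_nat Var \<sigma>) M = psub (case_nat Var \<tau>) M"
    by (rule Quo.IH) (use Quo.prems in \<open>auto simp: nth_Cons split: nat.splits\<close>)
  then show ?case by simp
next
  case (Unq \<Delta> l M A \<Gamma>)
  have "psub (\<lambda>j. \<sigma> (Suc j)) M = psub (\<lambda>j. \<tau> (Suc j)) M"
    by (rule Unq.IH) (use Unq.prems in \<open>force\<close>)
  then show ?case by simp
qed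

lemma red_psub:
  assumes "M \<rightarrow>\<^sub>\<beta> M'" "typing S l M A"
  shows "psub \<sigma> M \<rightarrow>\<^sub>\<beta> psub \<sigma> M'"
  using assms
proof (induction arbitrary: S l A \<sigma> rule: red.induct)
  case (beta M N)
  then show ?case by (simp add: psub_subst red.beta)
next
  case (unquote M)
  then obtain \<Delta> where "typing ([] # \<Delta>) l M A" by (rule typing_Unq_QuoE)
  \<comment> \<open>Passing through \<open>Unq (Quo M)\<close> discards \<open>\<sigma> 0\<close> in
    favour of \<open>Var\<close>. The two maps differ only on the empty context of \<open>M\<close>,
    so the contractum is the expected one.\<close>
  then have "psub (case_nat Var (\<lambda>j. \<sigma> (Suc j))) M = psub \<sigma> M"
    by (rule psub_cong) (auto simp: nth_Cons split: nat.splits)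
  then show ?case by (metis psub.simps(4,5) red.unquote)
qed (fastforce elim: typing_AbsE typing_AppE typing_QuoE typing_UnqE intro: red.intros)+

section \<open>Reduction sequences under constructors and in substituted terms\<close>

lemma reds_Abs: "red\<^sup>*\<^sup>* M M' \<Longrightarrow> red\<^sup>*\<^sup>* (Abs M) (Abs M')"
  by (induction rule: rtranclp_induct) (simp, metis red.Abs rtranclp.rtrancl_into_rtrancl)

lemma reds_Quo: "red\<^sup>*\<^sup>* M M' \<Longrightarrow> red\<^sup>*\<^sup>* (Quo M) (Quo M')"
  by (induction rule: rtranclp_induct) (simp, metis red.Quo rtranclp.rtrancl_into_rtrancl)

lemma reds_Unq: "red\<^sup>*\<^sup>* M M' \<Longrightarrow> red\<^sup>*\<^sup>* (Unq M) (Unq M')"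
  by (induction rule: rtranclp_induct) (simp, metis red.Unq rtranclp.rtrancl_into_rtrancl)

lemma reds_App:
  assumes "red\<^sup>*\<^sup>* M M'" "red\<^sup>*\<^sup>* N N'"
  shows "red\<^sup>*\<^sup>* (App M N) (App M' N')"
proof -
  have "red\<^sup>*\<^sup>* (App M N) (App M' N)"
    using assms(1) by (induction rule: rtranclp_induct) (simp, metis red.AppL rtranclp.rtrancl_into_rtrancl)
  moreover have "red\<^sup>*\<^sup>* (App M' N) (App M' N')"
    using assms(2) by (induction rule: rtranclp_induct) (simp, metis red.AppR rtranclp.rtrancl_into_rtrancl)
  ultimately show ?thesis by (rule rtranclp_trans)
qed

lemma reds_ren:
  assumes "red\<^sup>*\<^sup>* M M'" "typing S l M A"
  shows "red\<^sup>*\<^sup>* (ren \<xi> M) (ren \<xi> M')"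
  using assms
proof (induction rule: rtranclp_induct)
  case (step N N')
  then have "ren \<xi> N \<rightarrow>\<^sub>\<beta> ren \<xi> N'"
    unfolding ren_eq_psub using red_psub subject_reductions by blast
  then show ?case using step.IH[OF step.prems] by (rule rtranclp.rtrancl_into_rtrancl[rotated])
qed simp

text \<open>Many steps may be needed, as an image can be copied. The typing of
  \<open>\<sigma>\<close> serves the binder case: the images get shifted there, and
  \<open>reds_ren\<close> moves only reductions of typed terms along.\<close>

lemma reds_psub:
  assumes "typing S l M A" "typing_sub S' l \<sigma> S"
    and "\<And>j i. j < length S \<Longrightarrow> i < length (S ! j) \<Longrightarrow> red\<^sup>*\<^sup>* (\<sigma> j i) (\<tau> j i)"
  shows "red\<^sup>*\<^sup>* (psub \<sigma> M) (psub \<tau> M)"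
  using assms
proof (induction arbitrary: S' \<sigma> \<tau> rule: typing.induct)
  case (Var l \<Gamma> \<Delta> i A)
  then show ?case using Var.prems(2)[of 0 i] by simp
next
  case (Abs A \<Gamma> \<Delta> l M B)
  from Abs.prems(1) obtain \<Gamma>' \<Delta>' where S': "S' = \<Gamma>' # \<Delta>'" by (rule typing_sub_ConsE)
  have A: "ty_level l A" using typing_level[OF Abs.hyps] by (auto simp: stack_level_Cons ctx_level_def)
  have "red\<^sup>*\<^sup>* (psub (up \<sigma>) M) (psub (up \<tau>) M)"
  proof (rule Abs.IH)
    show "typing_sub ((A # \<Gamma>') # \<Delta>') l (up \<sigma>) ((A # \<Gamma>) # \<Delta>)"
      using Abs.prems(1) A unfolding S' by (rule typing_sub_up)
    fix j i assume ji: "j < length ((A # \<Gamma>) # \<Delta>)" "i < length (((A # \<Gamma>) # \<Delta>) ! j)"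
    show "red\<^sup>*\<^sup>* (up \<sigma> j i) (up \<tau> j i)"
    proof (cases "j = 0 \<and> i > 0")
      case True
      then obtain i' where i: "j = 0" "i = Suc i'" by (cases i) auto
      then have "typing S' l (\<sigma> 0 i') (\<Gamma> ! i')"
        using Abs.prems(1) ji by (force simp: typing_sub_def)
      then have "red\<^sup>*\<^sup>* (ren shift (\<sigma> 0 i')) (ren shift (\<tau> 0 i'))"
        using Abs.prems(2)[of 0 i'] i ji by (intro reds_ren) auto
      then show ?thesis using i by (simp add: up_def)
    next
      case False
      then show ?thesis using Abs.prems(2)[of j i] ji by (cases j) (auto simp: up_def)
    qed
  qed
  then show ?case by (simp add: reds_Abs)
next
  case (App \<Delta> l M A B N)
  then show ?case by (simp add: reds_App)
next
  case (Quo \<Delta> l M A)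
  have "red\<^sup>*\<^sup>* (psub (case_nat Var \<sigma>) M) (psub (case_nat Var \<tau>) M)"
    by (rule Quo.IH[OF typing_sub_Quo[OF Quo.prems(1)]])
      (use Quo.prems(2) in \<open>auto simp: nth_Cons split: nat.splits\<close>)
  then show ?case by (simp add: reds_Quo)
next
  case (Unq \<Delta> l M A \<Gamma>)
  from Unq.prems(1) obtain \<Gamma>' \<Delta>' where S': "S' = \<Gamma>' # \<Delta>'" by (rule typing_sub_ConsE)
  have "red\<^sup>*\<^sup>* (psub (\<lambda>j. \<sigma> (Suc j)) M) (psub (\<lambda>j. \<tau> (Suc j)) M)"
    using Unq.prems by (intro Unq.IH[of \<Delta>'] typing_sub_Unq) (force simp: S')+
  then show ?case by (simp add: reds_Unq)
qed

section \<open>Local confluence\<close>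

inductive_cases red_AbsE: "Abs M \<rightarrow>\<^sub>\<beta> N"
inductive_cases red_AppE: "App M M' \<rightarrow>\<^sub>\<beta> N"
inductive_cases red_QuoE: "Quo M \<rightarrow>\<^sub>\<beta> N"
inductive_cases red_UnqE: "Unq M \<rightarrow>\<^sub>\<beta> N"
inductive_cases red_VarE: "Var i \<rightarrow>\<^sub>\<beta> N"

text \<open>A step inside \<open>M\<close> survives the substitution as one step, by
  \<open>red_psub\<close>; a step inside \<open>N\<close> is repeated in every copy of
  \<open>N\<close>, by \<open>reds_psub\<close>.\<close>

lemma joinable_beta:
  assumes "typing S l (App (Abs M) N) A" "App (Abs M) N \<rightarrow>\<^sub>\<beta> P"
  shows "\<exists>Q. red\<^sup>*\<^sup>* (subst 0 0 N M) Q \<and> red\<^sup>*\<^sup>* P Q"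
proof -
  from assms(1) obtain B \<Gamma> \<Delta> where
    S: "S = \<Gamma> # \<Delta>" and M: "typing ((B # \<Gamma>) # \<Delta>) l M A" and N: "typing (\<Gamma> # \<Delta>) l N B"
    by (rule typing_betaE)
  from assms(2) consider "P = subst 0 0 N M"
    | M' where "P = App (Abs M') N" "M \<rightarrow>\<^sub>\<beta> M'"
    | N' where "P = App (Abs M) N'" "N \<rightarrow>\<^sub>\<beta> N'"
    by (fastforce elim: red_AppE red_AbsE)
  then show ?thesis
  proof cases
    case 2
    then have "subst 0 0 N M \<rightarrow>\<^sub>\<beta> subst 0 0 N M'"
      unfolding subst_eq_psub using M by (intro red_psub)
    then show ?thesis using 2 red.beta by blast
  next
    case 3
    then have "red\<^sup>*\<^sup>* (subst 0 0 N M) (subst 0 0 N' M)"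
      unfolding subst_eq_psub by (intro reds_psub[OF M typing_sub_single[OF N]]) (auto simp: single_def)
    then show ?thesis using 3 red.beta by blast
  qed auto
qed

lemma joinable_unquote:
  assumes "Unq (Quo M) \<rightarrow>\<^sub>\<beta> P"
  shows "\<exists>Q. red\<^sup>*\<^sup>* M Q \<and> red\<^sup>*\<^sup>* P Q"
  using assms
proof (cases rule: red.cases)
  case (Unq N)
  then show ?thesis by (metis r_into_rtranclp red_QuoE red.unquote)
qed auto

text \<open>If one of the steps contracts the root, the two joinability lemmas apply. Steps in the
  same subterm are joined by induction, and those in different subterms commute.\<close>

lemma locally_confluent:
  assumes "M \<rightarrow>\<^sub>\<beta> N\<^sub>1" "M \<rightarrow>\<^sub>\<beta> N\<^sub>2" "typing S l M A"
  shows "\<exists>P. red\<^sup>*\<^sup>* N\<^sub>1 P \<and> red\<^sup>*\<^sup>* N\<^sub>2 P"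
  using assms
proof (induction arbitrary: S l A N\<^sub>2 rule: red.induct)
  case (beta M N)
  then show ?case using joinable_beta by blast
next
  case (unquote M)
  then show ?case using joinable_unquote by blast
next
  case (Abs M M')
  from Abs.prems(1) obtain M'' where M'': "N\<^sub>2 = Abs M''" "M \<rightarrow>\<^sub>\<beta> M''" by (rule red_AbsE)
  from Abs.prems(2) obtain B \<Gamma> \<Delta> C where "S = \<Gamma> # \<Delta>" "typing ((B # \<Gamma>) # \<Delta>) l M C"
    by (rule typing_AbsE)
  from Abs.IH[OF M''(2) this(2)] show ?case using M''(1) reds_Abs by blast
next
  case (AppL M M' N)
  from AppL.prems(1) show ?case
  proof (cases rule: red.cases)
    case (beta P)
    then show ?thesis
      using joinable_beta[of S l P N A "App M' N"] AppL.prems(2) red.AppL[OF AppL.hyps] by blast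
  next
    case inner: (AppL M'')
    from AppL.prems(2) obtain B where "typing S l M (B \<rightarrow>\<^sub>t A)" by (rule typing_AppE)
    from AppL.IH[OF inner(2) this] show ?thesis using inner(1) reds_App by blast
  next
    case (AppR N')
    then show ?thesis using red.AppL[OF AppL.hyps, of N'] red.AppR[of N N' M'] by blast
  qed
next
  case (AppR N N' M)
  from AppR.prems(1) show ?case
  proof (cases rule: red.cases)
    case (beta P)
    then show ?thesis
      using joinable_beta[of S l P N A "App M N'"] AppR.prems(2) red.AppR[OF AppR.hyps] by blast
  next
    case (AppL M')
    then show ?thesis using red.AppR[OF AppR.hyps, of M'] red.AppL[of M M' N'] by blast
  next
    case inner: (AppR N'')
    from AppR.prems(2) obtain B where "typing S l N B" by (rule typing_AppE)
    from AppR.IH[OF inner(2) this] show ?thesis using inner(1) reds_App by blast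
  qed
next
  case (Quo M M')
  from Quo.prems(1) obtain M'' where M'': "N\<^sub>2 = Quo M''" "M \<rightarrow>\<^sub>\<beta> M''" by (rule red_QuoE)
  from Quo.prems(2) obtain l' B where "typing ([] # S) l' M B" by (rule typing_QuoE)
  from Quo.IH[OF M''(2) this] show ?case using M''(1) reds_Quo by blast
next
  case (Unq M M')
  from Unq.prems(1) show ?case
  proof (cases rule: red.cases)
    case (unquote)
    then show ?thesis
      using joinable_unquote[of N\<^sub>2 "Unq M'"] red.Unq[OF Unq.hyps] by blast
  next
    case inner: (Unq M'')
    from Unq.prems(2) obtain S' where "typing S' (Suc l) M (Box A)" by (rule typing_UnqE)
    from Unq.IH[OF inner(2) this] show ?thesis using inner(1) reds_Unq by blast
  qed
qed

section \<open>Reducible pure terms\<close>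

fun pure :: "tm \<Rightarrow> bool" where
  "pure (Var i) \<longleftrightarrow> True"
| "pure (Abs M) \<longleftrightarrow> pure M"
| "pure (App M N) \<longleftrightarrow> pure M \<and> pure N"
| "pure (Quo M) \<longleftrightarrow> False"
| "pure (Unq M) \<longleftrightarrow> False"

lemma pure_psubD: "pure (psub \<sigma> M) \<Longrightarrow> pure M"
  by (induction M arbitrary: \<sigma>) auto

lemma pure_ren: "pure (ren \<xi> M) = pure M"
  by (induction M arbitrary: \<xi>) auto

lemma pure_psub: "pure M \<Longrightarrow> (\<And>i. pure (\<sigma> 0 i)) \<Longrightarrow> pure (psub \<sigma> M)"
proof (induction M arbitrary: \<sigma>)
  case (Abs M)
  have "pure (up \<sigma> 0 i)" for i
    using Abs.prems(2) by (auto simp: up_def pure_ren split: nat.split)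
  then show ?case using Abs by simp
qed auto

lemma red_pure: "M \<rightarrow>\<^sub>\<beta> M' \<Longrightarrow> pure M \<Longrightarrow> pure M'"
  by (induction rule: red.induct) (auto simp: subst_eq_psub single_def intro!: pure_psub)

text \<open>In a pure term every redex is a beta redex, so the step is preserved by
  \<open>psub_subst\<close> alone. Reducible terms carry no typing derivation and rely on this
  version.\<close>

lemma red_psub_pure: "M \<rightarrow>\<^sub>\<beta> M' \<Longrightarrow> pure M \<Longrightarrow> psub \<sigma> M \<rightarrow>\<^sub>\<beta> psub \<sigma> M'"
  by (induction arbitrary: \<sigma> rule: red.induct) (auto simp: psub_subst intro: red.intros)

text \<open>\<open>accp\<close> descends towards the first argument, so the relation is the converse
  of reduction. This form provides induction over reducts.\<close>

abbreviation sn :: "tm \<Rightarrow> bool" where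
  "sn \<equiv> Wellfounded.accp (\<lambda>N M. M \<rightarrow>\<^sub>\<beta> N)"

lemma sn_step: "sn M \<Longrightarrow> M \<rightarrow>\<^sub>\<beta> M' \<Longrightarrow> sn M'"
  by (rule accp_downward) auto

lemma sn_intro: "(\<And>M'. M \<rightarrow>\<^sub>\<beta> M' \<Longrightarrow> sn M') \<Longrightarrow> sn M"
  by (rule accpI) auto

lemma sn_AppD: "sn (App M N) \<Longrightarrow> sn M"
proof (induction "App M N" arbitrary: M rule: accp_induct_rule)
  case 1
  show ?case
  proof (rule sn_intro)
    fix M' assume "M \<rightarrow>\<^sub>\<beta> M'"
    then show "sn M'" using 1(2)[of M'] by (auto intro: red.AppL)
  qed
qed

lemma sn_psubD: "sn (psub \<sigma> M) \<Longrightarrow> pure M \<Longrightarrow> sn M"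
proof (induction "psub \<sigma> M" arbitrary: M rule: accp_induct_rule)
  case 1
  show ?case
  proof (rule sn_intro)
    fix M' assume "M \<rightarrow>\<^sub>\<beta> M'"
    then show "sn M'" using 1(2)[of M'] 1(3) by (auto intro: red_psub_pure red_pure)
  qed
qed

text \<open>The candidates consist of untyped pure terms. \<open>Box\<close> is transparent because
  erasure removes both quotation and unquotation.\<close>

fun reducible :: "'b ty \<Rightarrow> tm set" where
  "reducible (Base l b) = {M. pure M \<and> sn M}"
| "reducible (A \<rightarrow>\<^sub>t B) = {M. pure M \<and> (\<forall>N \<in> reducible A. App M N \<in> reducible B)}"
| "reducible (Box A) = reducible A"

lemma reducible_pure: "M \<in> reducible A \<Longrightarrow> pure M"
  by (induction A) auto

lemma reducible_step: "M \<in> reducible A \<Longrightarrow> M \<rightarrow>\<^sub>\<beta> M' \<Longrightarrow> M' \<in> reducible A"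
proof (induction A arbitrary: M M')
  case (Arrow A B)
  then show ?case using red_pure red.AppL by fastforce
qed (auto intro: red_pure sn_step)

text \<open>Both conditions on reducibility depend on each other at an arrow type: the first at the target
  type needs a reducible variable at the source type, which the second one supplies.\<close>

lemma reducible_sn_neutral:
  "(M \<in> reducible A \<longrightarrow> sn M) \<and>
   (pure M \<longrightarrow> (\<forall>P. M \<noteq> Abs P) \<longrightarrow> (\<forall>M'. M \<rightarrow>\<^sub>\<beta> M' \<longrightarrow> M' \<in> reducible A) \<longrightarrow> M \<in> reducible A)"
proof (induction A arbitrary: M)
  case (Base l b)
  show ?case by (auto intro: sn_intro)
next
  case (Arrow A B)
  have var: "Var 0 \<in> reducible A"
    using Arrow.IH(1)[of "Var 0"] by (auto elim: red_VarE)
  have "App M N \<in> reducible B"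
    if M: "pure M" "\<forall>P. M \<noteq> Abs P" "\<forall>M'. M \<rightarrow>\<^sub>\<beta> M' \<longrightarrow> M' \<in> reducible (A \<rightarrow>\<^sub>t B)" and N: "N \<in> reducible A" for N
  proof -
    \<comment> \<open>As \<open>M\<close> is not an abstraction, \<open>App M N\<close> has no root
      step. Steps in \<open>M\<close> are covered by its hypothesis, steps in \<open>N\<close> by
      induction on \<open>sn N\<close>.\<close>
    have "sn N" using Arrow.IH(1) N by blast
    then show ?thesis using N
    proof (induction rule: accp_induct_rule)
      case (1 N)
      have "M' \<in> reducible B" if "App M N \<rightarrow>\<^sub>\<beta> M'" for M'
        using that
      proof (cases rule: red.cases)
        case (AppR N')
        then show ?thesis using 1 reducible_step by auto
      qed (use M 1 in auto)
      then show ?case using Arrow.IH(2)[of "App M N"] M(1) reducible_pure[OF 1(3)] by auto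
    qed
  qed
  moreover have "sn M" if "M \<in> reducible (A \<rightarrow>\<^sub>t B)"
    using that var Arrow.IH(2) sn_AppD by fastforce
  ultimately show ?case by auto
next
  case (Box A)
  then show ?case by simp
qed

lemma reducible_sn: "M \<in> reducible A \<Longrightarrow> sn M"
  using reducible_sn_neutral by blast

lemma reducible_neutral:
  "pure M \<Longrightarrow> (\<And>P. M \<noteq> Abs P) \<Longrightarrow> (\<And>M'. M \<rightarrow>\<^sub>\<beta> M' \<Longrightarrow> M' \<in> reducible A) \<Longrightarrow> M \<in> reducible A"
  using reducible_sn_neutral by blast

lemma reducible_Var: "Var i \<in> reducible A"
  by (rule reducible_neutral) (auto elim: red_VarE)

text \<open>The redex is not an abstraction, so its reducts decide. The root contractum is reducible
  by assumption; the other reducts are handled by nested inductions on \<open>sn M\<close> and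
  \<open>sn N\<close>.\<close>

lemma reducible_beta:
  assumes "sn M" "sn N" "pure M" "N \<in> reducible A" "\<And>N. N \<in> reducible A \<Longrightarrow> subst 0 0 N M \<in> reducible B"
  shows "App (Abs M) N \<in> reducible B"
  using assms
proof (induction arbitrary: N rule: accp_induct_rule)
  case (1 M)
  note IH = 1(2) and hyps = 1(4,6)
  from 1(3,5) show ?case
  proof (induction rule: accp_induct_rule)
    case (1 N)
    note N = 1(3)
    show ?case
    proof (rule reducible_neutral)
      show "pure (App (Abs M) N)" using hyps reducible_pure[OF N] by simp
      fix P assume "App (Abs M) N \<rightarrow>\<^sub>\<beta> P"
      then consider "P = subst 0 0 N M"
        | M' where "P = App (Abs M') N" "M \<rightarrow>\<^sub>\<beta> M'"
        | N' where "P = App (Abs M) N'" "N \<rightarrow>\<^sub>\<beta> N'"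
        by (fastforce elim: red_AppE red_AbsE)
      then show "P \<in> reducible B"
      proof cases
        case 1
        then show ?thesis using hyps N by simp
      next
        case 2
        \<comment> \<open>The assumption on contracta passes from \<open>M\<close> to
          \<open>M'\<close>, because reducibility is closed under reduction.\<close>
        have "subst 0 0 N' M' \<in> reducible B" if "N' \<in> reducible A" for N'
          using hyps(2)[OF that] red_psub_pure[OF 2(2) hyps(1)] unfolding subst_eq_psub
          by (rule reducible_step)
        then show ?thesis
          using 2 IH[of M' N] reducible_sn[OF N] N red_pure[OF 2(2) hyps(1)] by auto
      next
        case 3
        then show ?thesis using 1(2) reducible_step[OF N] by auto
      qed
    qed simp
  qed
qed

lemma reducible_Abs:
  assumes "\<And>N. N \<in> reducible A \<Longrightarrow> subst 0 0 N M \<in> reducible B"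
  shows "Abs M \<in> reducible (A \<rightarrow>\<^sub>t B)"
proof -
  \<comment> \<open>Variables are reducible at every type, and both purity and \<open>sn\<close> of
    this instance are reflected back to \<open>M\<close>.\<close>
  have "subst 0 0 (Var 0) M \<in> reducible B" by (rule assms[OF reducible_Var])
  then have "pure M" "sn M"
    unfolding subst_eq_psub using pure_psubD reducible_pure sn_psubD reducible_sn by metis+
  then have "App (Abs M) N \<in> reducible B" if "N \<in> reducible A" for N
    using reducible_beta[OF _ reducible_sn[OF that] _ that] assms by blast
  with \<open>pure M\<close> show ?thesis by simp
qed

section \<open>Erasure\<close>

text \<open>
  The erased term has a single context, so a variable of any level is shifted when a binder of
  any level is passed.
\<close>

definition upe :: "(nat \<Rightarrow> nat \<Rightarrow> tm) \<Rightarrow> nat \<Rightarrow> nat \<Rightarrow> tm" where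
  "upe \<rho> = case_nat (case_nat (Var 0) (\<lambda>i. ren shift (\<rho> 0 i))) (\<lambda>j i. ren shift (\<rho> (Suc j) i))"

text \<open>
  The term assigned to the variables of the empty context of a quotation is arbitrary, but has to
  be closed for erasure to commute with substitution.
\<close>

fun erase :: "(nat \<Rightarrow> nat \<Rightarrow> tm) \<Rightarrow> tm \<Rightarrow> tm" where
  "erase \<rho> (Var i) = \<rho> 0 i"
| "erase \<rho> (Abs M) = Abs (erase (upe \<rho>) M)"
| "erase \<rho> (App M N) = App (erase \<rho> M) (erase \<rho> N)"
| "erase \<rho> (Quo M) = erase (case_nat (\<lambda>i. Abs (Var 0)) \<rho>) M"
| "erase \<rho> (Unq M) = erase (\<lambda>j. \<rho> (Suc j)) M"

lemma erase_ren: "erase \<rho> (ren \<xi> M) = erase (\<lambda>j i. \<rho> j (\<xi> j i)) M"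
  by (induction M arbitrary: \<rho> \<xi>)
    (auto simp: upr_def upe_def fun_eq_iff split: nat.split intro!: arg_cong2[where f = erase])

lemma psub_erase: "psub \<sigma> (erase \<rho> M) = erase (\<lambda>j i. psub \<sigma> (\<rho> j i)) M"
proof (induction M arbitrary: \<rho> \<sigma>)
  case (Abs M)
  have "(\<lambda>j i. psub (up \<sigma>) (upe \<rho> j i)) = upe (\<lambda>j i. psub \<sigma> (\<rho> j i))"
    by (auto simp: upe_def fun_eq_iff psub_up_shift split: nat.split) (simp add: up_def)
  then show ?case by (simp add: Abs)
next
  case (Quo M)
  have "(\<lambda>j i. psub \<sigma> (case_nat (\<lambda>i. Abs (Var 0)) \<rho> j i)) =
      case_nat (\<lambda>i. Abs (Var 0)) (\<lambda>j i. psub \<sigma> (\<rho> j i))"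
    by (auto simp: fun_eq_iff up_def split: nat.split)
  then show ?case by (simp add: Quo)
qed auto

lemma ren_erase: "ren \<xi> (erase \<rho> M) = erase (\<lambda>j i. ren \<xi> (\<rho> j i)) M"
  by (simp add: ren_eq_psub psub_erase)

lemma erase_psub: "erase \<rho> (psub \<sigma> M) = erase (\<lambda>j i. erase (\<lambda>j'. \<rho> (j + j')) (\<sigma> j i)) M"
proof (induction M arbitrary: \<rho> \<sigma>)
  case (Abs M)
  have "erase (upe \<rho>) (ren shift N) = ren shift (erase \<rho> N)" for N
    by (auto simp: erase_ren ren_erase upe_def shift_def fun_eq_iff split: nat.split
        intro!: arg_cong2[where f = erase])
  \<comment> \<open>At \<open>j > 0\<close> \<open>up\<close> leaves the image alone and the shift
    comes from the entries of \<open>upe \<rho>\<close>; \<open>ren_erase\<close> pulls it out of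
    the erasure.\<close>
  then have "(\<lambda>j i. erase (\<lambda>j'. upe \<rho> (j + j')) (up \<sigma> j i)) =
      upe (\<lambda>j i. erase (\<lambda>j'. \<rho> (j + j')) (\<sigma> j i))"
    by (auto simp: up_def fun_eq_iff split: nat.split) (simp_all add: upe_def ren_erase)
  then show ?case by (simp add: Abs)
next
  case (Quo M)
  have "(\<lambda>j i. erase (\<lambda>j'. case_nat (\<lambda>i. Abs (Var 0)) \<rho> (j + j')) (case_nat Var \<sigma> j i)) =
      case_nat (\<lambda>i. Abs (Var 0)) (\<lambda>j i. erase (\<lambda>j'. \<rho> (j + j')) (\<sigma> j i))"
    by (auto simp: fun_eq_iff split: nat.split)
  then show ?case by (simp add: Quo)
qed auto

text \<open>Together with \<open>erase_subst\<close> this makes erasure commute with beta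
  contraction: either way the argument ends up as a new entry of the environment.\<close>

lemma subst_erase: "subst 0 0 N (erase (upe \<rho>) M) = erase (\<rho>(0 := case_nat N (\<rho> 0))) M"
proof -
  have "(\<lambda>j i. psub (single 0 0 N) (upe \<rho> j i)) = \<rho>(0 := case_nat N (\<rho> 0))"
    by (auto simp: upe_def fun_eq_iff psub_single_shift split: nat.split) (simp add: single_def)
  then show ?thesis by (simp add: subst_eq_psub psub_erase)
qed

lemma erase_subst: "erase \<rho> (subst 0 0 N M) = erase (\<rho>(0 := case_nat (erase \<rho> N) (\<rho> 0))) M"
proof -
  have "(\<lambda>j i. erase (\<lambda>j'. \<rho> (j + j')) (single 0 0 N j i)) = \<rho>(0 := case_nat (erase \<rho> N) (\<rho> 0))"
    by (auto simp: single_def fun_eq_iff split: nat.split)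
  then show ?thesis by (simp add: subst_eq_psub erase_psub)
qed

lemma erase_cong:
  assumes "typing S l M A" "\<And>j i. j < length S \<Longrightarrow> i < length (S ! j) \<Longrightarrow> \<rho> j i = \<tau> j i"
  shows "erase \<rho> M = erase \<tau> M"
  using assms
proof (induction arbitrary: \<rho> \<tau> rule: typing.induct)
  case (Var l \<Gamma> \<Delta> i A)
  then show ?case using Var.prems[of 0 i] by simp
next
  case (Abs A \<Gamma> \<Delta> l M B)
  have "erase (upe \<rho>) M = erase (upe \<tau>) M"
  proof (rule Abs.IH)
    show "upe \<rho> j i = upe \<tau> j i"
      if "j < length ((A # \<Gamma>) # \<Delta>)" "i < length (((A # \<Gamma>) # \<Delta>) ! j)" for j i
      using that Abs.prems[of j "if j = 0 then i - 1 else i"] by (auto simp: upe_def split: nat.split)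
  qed
  then show ?case by simp
next
  case (App \<Delta> l M A B N)
  then show ?case by (metis erase.simps(3))
next
  case (Quo \<Delta> l M A)
  have "erase (case_nat (\<lambda>i. Abs (Var 0)) \<rho>) M = erase (case_nat (\<lambda>i. Abs (Var 0)) \<tau>) M"
    by (rule Quo.IH) (use Quo.prems in \<open>auto simp: nth_Cons split: nat.splits\<close>)
  then show ?case by simp
next
  case (Unq \<Delta> l M A \<Gamma>)
  have "erase (\<lambda>j. \<rho> (Suc j)) M = erase (\<lambda>j. \<tau> (Suc j)) M"
    by (rule Unq.IH) (use Unq.prems in \<open>force\<close>)
  then show ?case by simp
qed

text \<open>The fundamental lemma of the reducibility method, with one environment for all levels.
  For an abstraction, \<open>subst_erase\<close> turns a reducible argument into an extension of the
  environment.\<close>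

lemma erase_reducible:
  assumes "typing S l M A"
    and "\<And>j i. j < length S \<Longrightarrow> i < length (S ! j) \<Longrightarrow> \<rho> j i \<in> reducible (S ! j ! i)"
  shows "erase \<rho> M \<in> reducible A"
  using assms
proof (induction arbitrary: \<rho> rule: typing.induct)
  case (Var l \<Gamma> \<Delta> i A)
  then show ?case using Var.prems[of 0 i] by simp
next
  case (Abs A \<Gamma> \<Delta> l M B)
  have "subst 0 0 N (erase (upe \<rho>) M) \<in> reducible B" if N: "N \<in> reducible A" for N
    unfolding subst_erase
  proof (rule Abs.IH)
    show "(\<rho>(0 := case_nat N (\<rho> 0))) j i \<in> reducible (((A # \<Gamma>) # \<Delta>) ! j ! i)"
      if "j < length ((A # \<Gamma>) # \<Delta>)" "i < length (((A # \<Gamma>) # \<Delta>) ! j)" for j i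
      using that N Abs.prems[of j "if j = 0 then i - 1 else i"] by (auto split: nat.split)
  qed
  then show ?case using reducible_Abs by (metis erase.simps(2))
next
  case (App \<Delta> l M A B N)
  then show ?case by simp
next
  case (Quo \<Delta> l M A)
  have "erase (case_nat (\<lambda>i. Abs (Var 0)) \<rho>) M \<in> reducible A"
    by (rule Quo.IH) (use Quo.prems in \<open>auto simp: nth_Cons split: nat.splits\<close>)
  then show ?case by simp
next
  case (Unq \<Delta> l M A \<Gamma>)
  have "erase (\<lambda>j. \<rho> (Suc j)) M \<in> reducible (Box A)"
    by (rule Unq.IH) (use Unq.prems in \<open>force\<close>)
  then show ?case by simp
qed

text \<open>The second alternative stems from \<open>unquote\<close>. The decrease in size is
  inherited by every surrounding constructor, including those that erasure deletes.\<close>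

lemma erase_red:
  assumes "M \<rightarrow>\<^sub>\<beta> M'" "typing S l M A"
  shows "erase \<rho> M \<rightarrow>\<^sub>\<beta> erase \<rho> M' \<or> erase \<rho> M = erase \<rho> M' \<and> size M' < size M"
  using assms
proof (induction arbitrary: S l A \<rho> rule: red.induct)
  case (beta M N)
  then show ?case by (auto simp: erase_subst simp flip: subst_erase intro: red.beta)
next
  case (unquote M)
  then obtain \<Delta> where "typing ([] # \<Delta>) l M A" by (rule typing_Unq_QuoE)
  then have "erase (case_nat (\<lambda>i. Abs (Var 0)) (\<lambda>j. \<rho> (Suc j))) M = erase \<rho> M"
    by (rule erase_cong) (auto simp: nth_Cons split: nat.splits)
  then show ?case by simp
next
  case (Abs M M')
  from Abs.prems show ?case
    by (rule typing_AbsE) (use Abs.IH[of _ _ _ "upe \<rho>"] in \<open>auto intro: red.Abs\<close>)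
next
  case (AppL M M' N)
  from AppL.prems show ?case
    by (rule typing_AppE) (use AppL.IH[of _ _ _ \<rho>] in \<open>auto intro: red.AppL\<close>)
next
  case (AppR N N' M)
  from AppR.prems show ?case
    by (rule typing_AppE) (use AppR.IH[of _ _ _ \<rho>] in \<open>auto intro: red.AppR\<close>)
next
  case (Quo M M')
  from Quo.prems show ?case
    by (rule typing_QuoE) (use Quo.IH in fastforce)
next
  case (Unq M M')
  from Unq.prems show ?case
    by (rule typing_UnqE) (use Unq.IH in fastforce)
qed

section \<open>Strong normalization and confluence\<close>

lemma typing_sn:
  assumes "typing S l M A"
  shows "sn M"
proof -
  \<comment> \<open>Any environment of reducible terms would do; a variable is reducible at every
    type.\<close>
  define \<rho> :: "nat \<Rightarrow> nat \<Rightarrow> tm" where "\<rho> = (\<lambda>j i. Var 0)"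
  have "sn (erase \<rho> M)"
    using erase_reducible[OF assms, of \<rho>] reducible_Var reducible_sn by (metis \<rho>_def)
  then show ?thesis using assms
  \<comment> \<open>A lexicographic argument: the outer induction covers steps that reduce the
    erased term, the inner one on size covers those that leave it fixed.\<close>
  proof (induction "erase \<rho> M" arbitrary: M rule: accp_induct_rule)
    case outer: 1
    from outer(3) outer(2) show ?case
    proof (induction M rule: measure_induct_rule[where f = size])
      case (less M)
      show ?case
      proof (rule sn_intro)
        fix M' assume M': "M \<rightarrow>\<^sub>\<beta> M'"
        then have "typing S l M' A" using less.prems(1) by (rule subject_reduction)
        then show "sn M'"
          using erase_red[OF M' less.prems(1), of \<rho>] less.IH[of M'] less.prems(2) by auto
      qed
    qed
  qed
qed

lemma sn_strongly_normalizing: "sn M \<Longrightarrow> strongly_normalizing M"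
  unfolding strongly_normalizing_def
proof (induction rule: accp_induct_rule)
  case (1 M)
  show ?case
  proof
    assume "\<exists>f :: nat \<Rightarrow> tm. f 0 = M \<and> (\<forall>i. f i \<rightarrow>\<^sub>\<beta> f (Suc i))"
    then obtain f :: "nat \<Rightarrow> tm" where f: "f 0 = M" "\<And>i. f i \<rightarrow>\<^sub>\<beta> f (Suc i)" by blast
    then have "M \<rightarrow>\<^sub>\<beta> f 1" by (metis One_nat_def)
    \<comment> \<open>The tail of the sequence starts at the reduct \<open>f 1\<close>.\<close>
    from 1(2)[OF this] show False using f(2) by (auto dest: spec[of _ "\<lambda>i. f (Suc i)"])
  qed
qed

text \<open>Newman's lemma, carried out on well-typed terms: subject reduction keeps the reducts
  within the reach of \<open>locally_confluent\<close>.\<close>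

lemma typing_confluent_at:
  assumes "typing S l M A"
  shows "confluent_at M"
  using typing_sn[OF assms] assms
proof (induction rule: accp_induct_rule)
  case (1 M)
  have IH: "\<exists>P. red\<^sup>*\<^sup>* N\<^sub>1 P \<and> red\<^sup>*\<^sup>* N\<^sub>2 P"
    if "M \<rightarrow>\<^sub>\<beta> M'" "red\<^sup>*\<^sup>* M' N\<^sub>1" "red\<^sup>*\<^sup>* M' N\<^sub>2" for M' N\<^sub>1 N\<^sub>2
    using 1(2)[of M'] that subject_reduction[OF that(1) 1(3)] unfolding confluent_at_def by blast
  show ?case unfolding confluent_at_def
  proof (intro allI impI)
    fix N\<^sub>1 N\<^sub>2 assume N: "red\<^sup>*\<^sup>* M N\<^sub>1" "red\<^sup>*\<^sup>* M N\<^sub>2"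
    show "\<exists>P. red\<^sup>*\<^sup>* N\<^sub>1 P \<and> red\<^sup>*\<^sup>* N\<^sub>2 P"
    proof (cases "M = N\<^sub>1 \<or> M = N\<^sub>2")
      case True
      then show ?thesis using N by blast
    next
      case False
      then obtain M\<^sub>1 M\<^sub>2 where
        M: "M \<rightarrow>\<^sub>\<beta> M\<^sub>1" "red\<^sup>*\<^sup>* M\<^sub>1 N\<^sub>1" "M \<rightarrow>\<^sub>\<beta> M\<^sub>2" "red\<^sup>*\<^sup>* M\<^sub>2 N\<^sub>2"
        using N by (metis converse_rtranclpE)
      obtain P where P: "red\<^sup>*\<^sup>* M\<^sub>1 P" "red\<^sup>*\<^sup>* M\<^sub>2 P"
        using locally_confluent[OF M(1,3) 1(3)] by blast
      \<comment> \<open>The local peak is closed at \<open>P\<close>. The induction hypothesis at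
        \<open>M\<^sub>1\<close> joins \<open>N\<^sub>1\<close> with \<open>P\<close>, and the one
        at \<open>M\<^sub>2\<close> joins the result with \<open>N\<^sub>2\<close>.\<close>
      obtain Q where Q: "red\<^sup>*\<^sup>* N\<^sub>1 Q" "red\<^sup>*\<^sup>* P Q" using IH[OF M(1,2) P(1)] by blast
      obtain R where "red\<^sup>*\<^sup>* Q R" "red\<^sup>*\<^sup>* N\<^sub>2 R"
        using IH[OF M(3) rtranclp_trans[OF P(2) Q(2)] M(4)] by blast
      then show ?thesis using Q(1) by (meson rtranclp_trans)
    qed
  qed
qed

theorem theorem2p6:
  shows "(\<forall>(\<Delta> :: 'b stack) l M M' A. typing \<Delta> l M A \<longrightarrow> M \<rightarrow>\<^sub>\<beta> M' \<longrightarrow> typing \<Delta> l M' A) \<and>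
    (\<forall>(\<Delta> :: 'b stack) l M A. typing \<Delta> l M A \<longrightarrow> strongly_normalizing M) \<and>
    (\<forall>(\<Delta> :: 'b stack) l M A. typing \<Delta> l M A \<longrightarrow> confluent_at M)"
  using subject_reduction typing_sn sn_strongly_normalizing typing_confluent_at by blast

end
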